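(* Let $m$ and $n\ge 4$ be even, and let $H\in\mathcal{A}^{(1,2)}(m,n)$. Let $(x_1\;x_2\;\dots\;x_n)$ be a row of $H$ such that $(x_1\;-x_2\;x_3\;\dots\;x_{n-1}\;-x_n)$ (signs alternating) is also a row of $H$, and let $T=\left[\begin{array}{c}C\\ D\end{array}\right]=[\,T^{[1]}\;T^{[2]}\,]$ be a $T$-submatrix of $H$. Let $\mathbb{X}=\{\mathcal{X}^{(1)},\dots,\mathcal{X}^{(\frac n2-2)}\}$ be a complete tensor set of LSESC of order $\frac n2-1$, let $\mathbf{X}^{(s)}_k$ be the $k$-th frontal slice of $\mathcal{X}^{(s)}$, and put $\mathbf{Y}^{(s)}_k=I_2\otimes\mathbf{X}^{(s)}_k$ for $1\le s\le \frac n2-2$, $1\le k\le\frac n2-1$. Let $H'$ be the matrix obtained from $H$ by deleting the two rows $(x_1\;x_2\;\dots\;x_n)$ and $(x_1\;-x_2\;\dots\;x_{n-1}\;-x_n)$, let $B_0=H'\otimes\mathbf{J}_{\frac n2-1}$, and let $$B=\left[\begin{array}{c|cccc} E_1(x_1,x_2)&T_{x_3,x_4}&T_{x_5,x_6}&\cdots&T_{x_{n-1},x_n}\\ E_2(x_1,x_2)&\mathbf{Y}^{(1)}_{1}T_{x_3,x_4}&\mathbf{Y}^{(1)}_{2}T_{x_5,x_6}&\cdots&\mathbf{Y}^{(1)}_{\frac n2-1}T_{x_{n-1},x_n}\\ E_3(x_1,x_2)&\mathbf{Y}^{(2)}_{1}T_{x_3,x_4}&\mathbf{Y}^{(2)}_{2}T_{x_5,x_6}&\cdots&\mathbf{Y}^{(2)}_{\frac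 n2-1}T_{x_{n-1},x_n}\\ \vdots&\vdots&\vdots&&\vdots\\ E_{\frac n2-1}(x_1,x_2)&\mathbf{Y}^{(\frac n2-2)}_{1}T_{x_3,x_4}&\mathbf{Y}^{(\frac n2-2)}_{2}T_{x_5,x_6}&\cdots&\mathbf{Y}^{(\frac n2-2)}_{\frac n2-1}T_{x_{n-1},x_n} \end{array}\right],$$ where $$E_i(x_1,x_2)=\left[\begin{array}{c} \mathbf{J}_{\frac n2-1}^{\top}\otimes[\,x_1\mathbf{c}^{[1]}_i\;\;x_2\mathbf{c}^{[2]}_i\,]\\ \mathbf{J}_{\frac n2-1}^{\top}\otimes[\,x_1\mathbf{d}^{[1]}_i\;\;x_2\mathbf{d}^{[2]}_i\,] \end{array}\right],\qquad T_{x_d,x_{d+1}}=[\,x_dT^{[1]}\;\;x_{d+1}T^{[2]}\,].$$ Then the matrix $$\Psi_{\mathbb{X}}(H)=\left[\begin{array}{c}B_0\\ B\end{array}\right]$$ is a Butson matrix of order $n(\frac n2-1)$ whose entries are complex $m$-th roots of unity, i.e. a $BH(m,(\frac n2-1)n)$.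
   Context: A Butson matrix $BH(m,n)$ is an $n\times n$ matrix $M$ whose entries are complex $m$-th roots of unity and which satisfies $MM^*=nI_n$, where $M^*$ is the conjugate transpose. It is normalized if its first row and first column consist entirely of ones. $\mathcal{BH}(m,n)$ is the set of all normalized $BH(m,n)$ matrices. $\mathbf{J}_k$ is the $1\times k$ row vector of all ones. The Kronecker product of $X=(x_{ij})$ and $Y$ is $X\otimes Y=(x_{ij}Y)$. For even $m,n$: $\mathcal{A}^{(1)}(m,n)$ is the set of $M\in\mathcal{BH}(m,n)$ that have a row $(x_1\;x_2\;\dots\;x_n)$ such that $(x_1\;-x_2\;x_3\;\dots\;x_{n-1}\;-x_n)$ is also a row of $M$. $\mathcal{A}^{(2)}(m,n)$ is the set of $M\in\mathcal{BH}(m,n)$ that have a row and a column, both with all entries in $\{1,-1\}$, whose common entry is $-1$. $\mathcal{A}^{(1,2)}(m,n)=\mathcal{A}^{(1)}(m,n)\cap\mathcal{A}^{(2)}(m,n)$. $T$-submatrix: for $H\in\mathcal{A}^{(2)}(m,n)$, the rows and columns of $H$ can be permuted (moving to second position a row and a column of $H$, both with all entries in $\{1,-1\}$, whose common entry is $-1$, and then sorting) so as to obtain a matrix whose first row and first column are all ones, and whose second row and second column both are $(1,-1,1,\dots,1,-1,\dots,-1)$ with, after the first two entries, $\frac{n-2}2$ entries $1$ followed by $\frac{n-2}2$ entries $-1$. Any $(n-2)\times(n-2)$ matrix $T$ obtained by deleting the first two rows and the first two columns of such a rearranged matrix is called a $T$-submatrix of $H$. Write $T=\left[\begin{array}{c}C\\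 D\end{array}\right]$ with $C,D$ of size $\frac{n-2}2\times(n-2)$ (top and bottom halves), and $T=[\,T^{[1]}\;T^{[2]}\,]$, $C=[\,C^{[1]}\;C^{[2]}\,]$, $D=[\,D^{[1]}\;D^{[2]}\,]$, where the superscript $[1]$ denotes the first $\frac n2-1$ columns and $[2]$ the remaining $\frac n2-1$ columns. $\mathbf{c}^{[1]}_i,\mathbf{c}^{[2]}_i,\mathbf{d}^{[1]}_i,\mathbf{d}^{[2]}_i$ denote the $i$-th rows of $C^{[1]},C^{[2]},D^{[1]},D^{[2]}$. A Latin square of order $k$ is a $k\times k$ matrix with entries in $\{1,\dots,k\}$ in which each symbol appears exactly once in each row and in each column. Two Latin squares $L=(l_{ij})$ and $L'=(l'_{ij})$ of order $k$ are LSESC if for all $i,i'\in\{1,\dots,k\}$ there is a unique $j$ with $l_{ij}=l'_{i'j}$. A complete set of LSESC of order $k$ is a set $\{L^{(1)},\dots,L^{(k-1)}\}$ of $k-1$ Latin squares of order $k$, any two distinct members of which are LSESC. To a Latin square $L$ of order $k$ associate the cubic tensor $F(L)$ whose frontal slices are the $k\times k$ permutation matrices $\mathbf{X}_1,\dots,\mathbf{X}_k$, the $(i,j)$ entry of $\mathbf{X}_t$ being $1$ if $l_{it}=j$ and $0$ otherwise. A complete tensor set of LSESC of order $k$ is $\{F(L^{(1)}),\dots,F(L^{(k-1)})\}$ for a complete set of LSESC $\{L^{(1)},\dots,L^{(k-1)}\}$ of order $k$. *)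

theory Defs
  imports
    "HOL-Combinatorics.Permutations"
    "Jordan_Normal_Form.Matrix"
    "Jordan_Normal_Form.DL_Submatrix"
    "Jordan_Normal_Form.Schur_Decomposition"
begin

text \<open>
  Rows, columns and blocks are numbered from 0, following \<open>Jordan_Normal_Form\<close>; the symbols of a
  Latin square of order \<open>k\<close> are \<open>1, \<dots>, k\<close>.
\<close>

section \<open>Block matrices\<close>

definition kronecker :: "'a::times mat \<Rightarrow> 'a mat \<Rightarrow> 'a mat" (infixl "\<otimes>\<^sub>K" 70) where
  "X \<otimes>\<^sub>K Y = mat (dim_row X * dim_row Y) (dim_col X * dim_col Y)
     (\<lambda>(i, j). X $$ (i div dim_row Y, j div dim_col Y) * Y $$ (i mod dim_row Y, j mod dim_col Y))"

definition ones_row :: "nat \<Rightarrow> 'a::one mat" where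
  "ones_row k = mat 1 k (\<lambda>_. 1)"

definition append_cols :: "'a::zero mat \<Rightarrow> 'a mat \<Rightarrow> 'a mat" (infixr "@\<^sub>c" 65) where
  "A @\<^sub>c B = four_block_mat A B (0\<^sub>m 0 (dim_col A)) (0\<^sub>m 0 (dim_col B))"

text \<open>The \<open>r \<times> c\<close> array of blocks \<open>f s t\<close>, each of size \<open>a \<times> b\<close>.\<close>

definition block_grid :: "nat \<Rightarrow> nat \<Rightarrow> nat \<Rightarrow> nat \<Rightarrow> (nat \<Rightarrow> nat \<Rightarrow> 'a mat) \<Rightarrow> 'a mat" where
  "block_grid r c a b f =
     mat (r * a) (c * b) (\<lambda>(i, j). f (i div a) (j div b) $$ (i mod a, j mod b))"

section \<open>Butson matrices\<close>

definition butson :: "nat \<Rightarrow> nat \<Rightarrow> complex mat set" where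
  "butson m n = {M \<in> carrier_mat n n.
     (\<forall>i<n. \<forall>j<n. M $$ (i, j) ^ m = 1) \<and> M * mat_adjoint M = of_nat n \<cdot>\<^sub>m 1\<^sub>m n}"

definition normalized_butson :: "nat \<Rightarrow> nat \<Rightarrow> complex mat set" where
  "normalized_butson m n =
     {M \<in> butson m n. (\<forall>j<n. M $$ (0, j) = 1) \<and> (\<forall>i<n. M $$ (i, 0) = 1)}"

definition alternate :: "complex vec \<Rightarrow> complex vec" where
  "alternate x = vec (dim_vec x) (\<lambda>j. (- 1) ^ j * x $ j)"

definition A1 :: "nat \<Rightarrow> nat \<Rightarrow> complex mat set" where
  "A1 m n = {M \<in> normalized_butson m n. \<exists>x. x \<in> set (rows M) \<and> alternate x \<in> set (rows M)}"

definition A2 :: "nat \<Rightarrow> nat \<Rightarrow> complex mat set" where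
  "A2 m n = {M \<in> normalized_butson m n. \<exists>r<n. \<exists>c<n.
     (\<forall>j<n. M $$ (r, j) \<in> {1, - 1}) \<and> (\<forall>i<n. M $$ (i, c) \<in> {1, - 1}) \<and> M $$ (r, c) = - 1}"

definition A12 :: "nat \<Rightarrow> nat \<Rightarrow> complex mat set" where
  "A12 m n = A1 m n \<inter> A2 m n"

section \<open>T-submatrices\<close>

definition sorted_pattern :: "nat \<Rightarrow> complex vec" where
  "sorted_pattern n = vec n (\<lambda>j. if j = 0 then 1 else if j = 1 then - 1
     else if j < 2 + (n - 2) div 2 then 1 else - 1)"

text \<open>
  The row (column) moved to second position need not be mentioned separately: the condition on the
  second row and column of the rearranged matrix says that it has entries in \<open>{1, -1}\<close>, and that
  the common entry is \<open>-1\<close>.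
\<close>

definition T_submatrices :: "complex mat \<Rightarrow> complex mat set" where
  "T_submatrices H = (let n = dim_row H in
     {T. \<exists>\<sigma> \<tau> R. \<sigma> permutes {..<n} \<and> \<tau> permutes {..<n} \<and>
        R = mat n n (\<lambda>(i, j). H $$ (\<sigma> i, \<tau> j)) \<and>
        (\<forall>j<n. R $$ (0, j) = 1) \<and> (\<forall>i<n. R $$ (i, 0) = 1) \<and>
        row R 1 = sorted_pattern n \<and> col R 1 = sorted_pattern n \<and>
        T = mat (n - 2) (n - 2) (\<lambda>(i, j). R $$ (i + 2, j + 2))})"

section \<open>Latin squares and LSESC\<close>

definition latin_square :: "nat \<Rightarrow> nat mat \<Rightarrow> bool" where
  "latin_square k L \<longleftrightarrow> L \<in> carrier_mat k k \<and>
     (\<forall>i<k. \<forall>j<k. L $$ (i, j) \<in> {1..k}) \<and>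
     (\<forall>i<k. \<forall>a\<in>{1..k}. \<exists>!j. j < k \<and> L $$ (i, j) = a) \<and>
     (\<forall>j<k. \<forall>a\<in>{1..k}. \<exists>!i. i < k \<and> L $$ (i, j) = a)"

definition LSESC :: "nat \<Rightarrow> nat mat \<Rightarrow> nat mat \<Rightarrow> bool" where
  "LSESC k L L' \<longleftrightarrow> (\<forall>i<k. \<forall>i'<k. \<exists>!j. j < k \<and> L $$ (i, j) = L' $$ (i', j))"

definition complete_LSESC :: "nat \<Rightarrow> nat mat set \<Rightarrow> bool" where
  "complete_LSESC k \<L> \<longleftrightarrow> finite \<L> \<and> card \<L> = k - 1 \<and> (\<forall>L\<in>\<L>. latin_square k L) \<and>
     (\<forall>L\<in>\<L>. \<forall>L'\<in>\<L>. L \<noteq> L' \<longrightarrow> LSESC k L L')"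

text \<open>
  A cubic tensor is represented by the list of its frontal slices. The column index \<open>j\<close> stands for
  the symbol \<open>j + 1\<close>.
\<close>

definition tensor_of :: "nat mat \<Rightarrow> complex mat list" where
  "tensor_of L = (let k = dim_row L in
     map (\<lambda>t. mat k k (\<lambda>(i, j). if L $$ (i, t) = j + 1 then 1 else 0)) [0..<k])"

definition complete_tensor_set :: "nat \<Rightarrow> complex mat list set \<Rightarrow> bool" where
  "complete_tensor_set k \<X> \<longleftrightarrow> (\<exists>\<L>. complete_LSESC k \<L> \<and> \<X> = tensor_of ` \<L>)"

section \<open>The construction\<close>

text \<open>
  \<open>T\<close> has size \<open>2 k \<times> 2 k\<close>, \<open>C\<close> and \<open>D\<close> are its top and bottom halves, and \<open>y\<close>, \<open>z\<close> stand for
  \<open>x\<^sub>d\<close>, \<open>x\<^sub>d\<^sub>+\<^sub>1\<close>.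
\<close>

definition T_scaled :: "nat \<Rightarrow> complex mat \<Rightarrow> complex \<Rightarrow> complex \<Rightarrow> complex mat" where
  "T_scaled k T y z =
     (y \<cdot>\<^sub>m submatrix T UNIV {..<k}) @\<^sub>c (z \<cdot>\<^sub>m submatrix T UNIV {k..<2 * k})"

definition E_block :: "nat \<Rightarrow> complex mat \<Rightarrow> nat \<Rightarrow> complex \<Rightarrow> complex \<Rightarrow> complex mat" where
  "E_block k T i y z = (let
       C1 = submatrix T {..<k} {..<k}; C2 = submatrix T {..<k} {k..<2 * k};
       D1 = submatrix T {k..<2 * k} {..<k}; D2 = submatrix T {k..<2 * k} {k..<2 * k}
     in ((ones_row k)\<^sup>T \<otimes>\<^sub>K mat_of_row (y \<cdot>\<^sub>v row C1 i @\<^sub>v z \<cdot>\<^sub>v row C2 i)) @\<^sub>r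
        ((ones_row k)\<^sup>T \<otimes>\<^sub>K mat_of_row (y \<cdot>\<^sub>v row D1 i @\<^sub>v z \<cdot>\<^sub>v row D2 i)))"

text \<open>
  The list \<open>Xs\<close> enumerates the tensors. Since both are numbered from 0, block row \<open>s > 0\<close> uses
  \<open>Xs ! (s - 1)\<close>, and block column \<open>t > 0\<close> uses slice \<open>t - 1\<close> and the entries \<open>2 t\<close>, \<open>2 t + 1\<close>
  of \<open>x\<close>.
\<close>

definition B_matrix :: "nat \<Rightarrow> complex mat list list \<Rightarrow> complex vec \<Rightarrow> complex mat \<Rightarrow> complex mat" where
  "B_matrix k Xs x T = block_grid k (k + 1) (2 * k) (2 * k) (\<lambda>s t.
     if t = 0 then E_block k T s (x $ 0) (x $ 1)
     else let S = T_scaled k T (x $ (2 * t)) (x $ (2 * t + 1)) in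
       if s = 0 then S else (1\<^sub>m 2 \<otimes>\<^sub>K (Xs ! (s - 1) ! (t - 1))) * S)"

text \<open>\<open>p\<close> and \<open>q\<close> are the indices of the row \<open>x\<close> and of its alternated row.\<close>

definition Psi ::
  "complex mat list list \<Rightarrow> complex mat \<Rightarrow> nat \<Rightarrow> nat \<Rightarrow> complex mat \<Rightarrow> complex mat" where
  "Psi Xs H p q T = (let k = dim_row H div 2 - 1 in
     (submatrix H (- {p, q}) UNIV \<otimes>\<^sub>K ones_row k) @\<^sub>r B_matrix k Xs (row H p) T)"

end

theory Submission
  imports Defs
begin

text \<open>
  Orthogonality of \<open>H\<close> with its first two rows and columns split off says that two rows of \<open>T\<close>
  from the same half have inner product \<open>n [a = b] - 2\<close>, that rows from different halves are
  orthogonal, and that the two halves of a row of \<open>T\<close> sum to \<open>-1, -1\<close> (top) or \<open>-1, 1\<close> (bottom).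
  With \<open>k = n/2 - 1\<close>, a row of \<open>B\<close> is a concatenation of \<open>k + 1\<close> rows of \<open>T\<close> from one half, scaled by
  the unimodular \<open>x\<close>, so two rows of \<open>B\<close> have inner product \<open>0\<close> (different halves) or
  \<open>n (z - 1)\<close>, where \<open>z\<close> counts the blocks in which the two rows use the same row of \<open>T\<close>. The Latin
  and LSESC properties are exactly \<open>z = 1\<close> for distinct rows. Against a row of \<open>B\<^sub>0\<close>, the half sums
  turn a row of \<open>B\<close> into \<open>- x\<close> (top) or minus the alternated row (bottom), both orthogonal to the
  rows of \<open>H'\<close>.
\<close>

section \<open>Sums over blocks and the Butson condition on entries\<close>

lemma sum_div_mod_split:
  fixes f :: "nat \<Rightarrow> nat \<Rightarrow> 'a::comm_monoid_add"
  shows "(\<Sum>j<a * b. f (j div b) (j mod b)) = (\<Sum>t<a. \<Sum>u<b. f t u)"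
proof -
  have "(\<Sum>u<b. f t u) = (\<Sum>j = t * b..<t * b + b. f (j div b) (j mod b))" for t
    using sum.shift_bounds_nat_ivl[of "\<lambda>j. f (j div b) (j mod b)" 0 "t * b" b]
    by (simp add: atLeast0LessThan add.commute)
  then show ?thesis
    by (simp add: sum.nat_group)
qed

lemma mult_mat_adjoint_index:
  fixes M :: "complex mat"
  assumes "M \<in> carrier_mat n n" "i < n" "j < n"
  shows "(M * mat_adjoint M) $$ (i, j) = (\<Sum>l<n. M $$ (i, l) * cnj (M $$ (j, l)))"
  using assms
  by (auto simp: mat_adjoint_def scalar_prod_def mat_of_rows_def atLeast0LessThan intro!: sum.cong)

text \<open>Entry \<open>(i, j)\<close> of \<open>M * mat_adjoint M\<close> is the Hermitian inner
  product of rows \<open>i\<close> and \<open>j\<close>, so orthogonality can be argued row against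
  row.\<close>

lemma butson_iff:
  "M \<in> butson m n \<longleftrightarrow> M \<in> carrier_mat n n \<and> (\<forall>i<n. \<forall>j<n. M $$ (i, j) ^ m = 1) \<and>
     (\<forall>i<n. \<forall>j<n. (\<Sum>l<n. M $$ (i, l) * cnj (M $$ (j, l))) = (if i = j then of_nat n else 0))"
proof (cases "M \<in> carrier_mat n n")
  case True
  then have "mat_adjoint M \<in> carrier_mat n n"
    by (auto simp: mat_adjoint_def)
  with True have "M * mat_adjoint M = of_nat n \<cdot>\<^sub>m 1\<^sub>m n \<longleftrightarrow>
     (\<forall>i<n. \<forall>j<n. (M * mat_adjoint M) $$ (i, j) = (if i = j then of_nat n else 0))"
    by (auto simp: mat_eq_iff)
  also have "\<dots> \<longleftrightarrow> (\<forall>i<n. \<forall>j<n. (\<Sum>l<n. M $$ (i, l) * cnj (M $$ (j, l))) = (if i = j then of_nat n else 0))"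
    using mult_mat_adjoint_index[OF True] by simp
  finally show ?thesis
    using True by (simp add: butson_def)
qed (simp add: butson_def)

text \<open>Roots of unity have norm 1, and \<open>z * cnj z\<close> is the squared norm; for
  \<open>m = 0\<close> the equation would say nothing about \<open>z\<close>.\<close>

lemma root_mult_cnj:
  fixes z :: complex
  assumes "z ^ m = 1" "m > 0"
  shows "z * cnj z = 1"
proof -
  have "norm z = 1"
    using power_eq_1_iff[OF assms(1)] assms(2) by simp
  then show ?thesis
    by (simp add: complex_norm_square[symmetric])
qed

section \<open>Entries of the individual blocks\<close>

lemma
  assumes "u < k"
  shows pick_lessThan: "pick {..<k} u = u"
    and pick_upper_half: "pick {k..<2 * k} u = k + u"
proof -
  have "{a \<in> {..<k}. a < u} = {..<u}" "{a \<in> {k..<2 * k}. a < k + u} = {k..<k + u}"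
    using assms by auto
  then show "pick {..<k} u = u" "pick {k..<2 * k} u = k + u"
    using pick_card_in_set[of u "{..<k}"] pick_card_in_set[of "k + u" "{k..<2 * k}"] assms
    by auto
qed

lemma half_div:
  assumes "a < 2 * k"
  shows "a div k = (if a < k then 0 else 1 :: nat)"
  using assms by (auto intro: div_nat_eqI)

lemma half_index_sets:
  fixes k :: nat
  shows "{i. i < 2 * k \<and> i < k} = {..<k}" "{i. i < 2 * k \<and> k \<le> i \<and> i < 2 * k} = {k..<2 * k}"
  by auto

lemma T_scaled_carrier: "T \<in> carrier_mat (2 * k) (2 * k) \<Longrightarrow> T_scaled k T y z \<in> carrier_mat (2 * k) (2 * k)"
  by (auto simp: T_scaled_def append_cols_def dim_submatrix half_index_sets)

lemma T_scaled_index: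
  assumes "T \<in> carrier_mat (2 * k) (2 * k)" "a < 2 * k" "u < 2 * k"
  shows "T_scaled k T y z $$ (a, u) = (if u < k then y else z) * T $$ (a, u)"
  using assms
  by (auto simp: T_scaled_def append_cols_def dim_submatrix half_index_sets submatrix_index
      pick_UNIV pick_lessThan pick_upper_half)

text \<open>The Kronecker product with a column of ones repeats one row \<open>k\<close> times, so
  \<open>a\<close> matters only through \<open>a div k\<close>, which is 0 in the half
  \<open>C\<close> and 1 in the half \<open>D\<close>.\<close>

lemma E_block_index:
  assumes "T \<in> carrier_mat (2 * k) (2 * k)" "a < 2 * k" "u < 2 * k" "s < k"
  shows "E_block k T s y z $$ (a, u) =
    (if u < k then y else z) * T $$ (k * (a div k) + s, u)"
  using assms
  by (auto simp: half_div E_block_def append_rows_def dim_submatrix half_index_sets submatrix_index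
      pick_lessThan pick_upper_half kronecker_def ones_row_def append_vec_def Let_def)

text \<open>Row \<open>i\<close> of \<open>X\<close> is the unit vector at \<open>f i\<close>, so
  left multiplication by \<open>X\<close> selects rows; the factor \<open>1\<^sub>m 2\<close> does
  this within each half separately.\<close>

lemma slice_kronecker_mult_index:
  fixes S :: "complex mat"
  assumes "S \<in> carrier_mat (2 * k) c" "a < 2 * k" "u < c" "f (a mod k) < k"
    and "X = mat k k (\<lambda>(i, j). if f i = j then 1 else 0)"
  shows "((1\<^sub>m 2 \<otimes>\<^sub>K X) * S) $$ (a, u) = S $$ (k * (a div k) + f (a mod k), u)"
proof -
  let ?b = "k * (a div k) + f (a mod k)"
  have k: "k > 0" using assms(4) by simp
  have d: "a div k < 2" if "a < 2 * k" for a
    using that by (simp add: less_mult_imp_div_less)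
  have "?b < k * (a div k) + k * 1"
    using assms(4) by simp
  also have "\<dots> = k * (a div k + 1)" by (simp add: algebra_simps)
  also have "\<dots> \<le> k * 2"
    using d[OF assms(2)] by (intro mult_left_mono) auto
  finally have b: "?b < 2 * k" by simp
  have "((1\<^sub>m 2 \<otimes>\<^sub>K X) * S) $$ (a, u)
      = (\<Sum>b<2 * k. 1\<^sub>m 2 $$ (a div k, b div k) * X $$ (a mod k, b mod k) * S $$ (b, u))"
    using assms by (auto simp: kronecker_def scalar_prod_def atLeast0LessThan intro!: sum.cong)
  also have "\<dots> = (\<Sum>b<2 * k. if b = ?b then S $$ (b, u) else 0)"
  proof (intro sum.cong refl)
    fix b assume "b \<in> {..<2 * k}"
    moreover have "b = ?b \<longleftrightarrow> b div k = a div k \<and> b mod k = f (a mod k)"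
      using assms(4) k by (auto simp: mult.commute) (metis mult_div_mod_eq)
    ultimately show "1\<^sub>m 2 $$ (a div k, b div k) * X $$ (a mod k, b mod k) * S $$ (b, u)
        = (if b = ?b then S $$ (b, u) else 0)"
      using k d[OF assms(2)] d[of b] by (auto simp: assms(5))
  qed
  also have "\<dots> = S $$ (?b, u)"
    using b by simp
  finally show ?thesis .
qed

section \<open>Latin squares and their tensors\<close>

text \<open>The symbol at \<open>(i, t)\<close> is the position of the 1 in row \<open>i\<close> of
  slice \<open>t\<close>; that 1 exists because symbols lie in \<open>{1..k}\<close>.\<close>

lemma tensor_of_inj:
  assumes "latin_square k L" "latin_square k L'" "tensor_of L = tensor_of L'"
  shows "L = L'"
proof (rule eq_matI)
  have c: "L \<in> carrier_mat k k" "L' \<in> carrier_mat k k"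
    using assms by (auto simp: latin_square_def)
  then show "dim_row L = dim_row L'" "dim_col L = dim_col L'" by auto
  fix i t assume "i < dim_row L'" "t < dim_col L'"
  then have it: "i < k" "t < k" using c by auto
  then have "L $$ (i, t) \<in> {1..k}"
    using assms by (auto simp: latin_square_def)
  then obtain j where j: "L $$ (i, t) = j + 1" "j < k"
    by (metis Suc_eq_plus1 Suc_le_eq atLeastAtMost_iff le_add_diff_inverse2)
  have "tensor_of L ! t $$ (i, j) = tensor_of L' ! t $$ (i, j)"
    using assms(3) by simp
  then show "L $$ (i, t) = L' $$ (i, t)"
    using c it j by (auto simp: tensor_of_def Let_def split: if_splits)
qed

text \<open>Pulls the enumeration of tensors back to Latin squares. Injectivity of
  \<open>tensor_of\<close> gives the length, and distinctness of \<open>Xs\<close> puts different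
  squares at different positions, so that LSESC applies to them.\<close>

lemma complete_tensor_set_enum:
  assumes "complete_tensor_set k \<X>" "distinct Xs" "set Xs = \<X>"
  obtains Ls where "Xs = map tensor_of Ls" "length Ls = k - 1"
    and "\<And>s. s < k - 1 \<Longrightarrow> latin_square k (Ls ! s)"
    and "\<And>s s'. s < k - 1 \<Longrightarrow> s' < k - 1 \<Longrightarrow> s \<noteq> s' \<Longrightarrow> LSESC k (Ls ! s) (Ls ! s')"
proof -
  obtain \<L> where L: "complete_LSESC k \<L>" "\<X> = tensor_of ` \<L>"
    using assms(1) by (auto simp: complete_tensor_set_def)
  have inj: "inj_on tensor_of \<L>"
    using L(1) tensor_of_inj by (intro inj_onI) (auto simp: complete_LSESC_def)
  have "Xs \<in> lists (tensor_of ` \<L>)"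
    using assms(3) L(2) by auto
  then obtain Ls where Ls: "Xs = map tensor_of Ls" "set Ls \<subseteq> \<L>"
    by (auto simp: lists_image)
  have len: "length Ls = k - 1"
    using L inj Ls(1) assms(2,3) by (metis card_image complete_LSESC_def distinct_card length_map)
  have dist: "distinct Ls"
    using Ls(1) assms(2) by (simp add: distinct_map)
  show thesis
  proof (rule that[OF Ls(1) len])
    fix s assume "s < k - 1"
    then show "latin_square k (Ls ! s)"
      using L(1) Ls(2) len nth_mem[of s Ls] unfolding complete_LSESC_def by (metis subsetD)
  next
    fix s s' assume "s < k - 1" "s' < k - 1" "s \<noteq> s'"
    then have "Ls ! s \<in> \<L>" "Ls ! s' \<in> \<L>" "Ls ! s \<noteq> Ls ! s'"
      using Ls(2) len dist nth_mem[of s Ls] nth_mem[of s' Ls] by (auto simp: nth_eq_iff_index_eq)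
    then show "LSESC k (Ls ! s) (Ls ! s')"
      using L(1) by (auto simp: complete_LSESC_def)
  qed
qed

section \<open>Inner products and half sums of the rows of T\<close>

lemma T_submatrix_gram:
  assumes H: "H \<in> butson m n" and n: "n = 2 * k + 2"
    and T: "T \<in> T_submatrices H"
  shows "T \<in> carrier_mat (2 * k) (2 * k)"
    and "\<And>a u. a < 2 * k \<Longrightarrow> u < 2 * k \<Longrightarrow> T $$ (a, u) ^ m = 1"
    and "\<And>a b. a < 2 * k \<Longrightarrow> b < 2 * k \<Longrightarrow> (\<Sum>u<2 * k. T $$ (a, u) * cnj (T $$ (b, u))) =
        (if a = b then of_nat n else 0) - (if a div k = b div k then 2 else 0)"
    and "\<And>a. a < 2 * k \<Longrightarrow> (\<Sum>u<k. T $$ (a, u)) = -1"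
    and "\<And>a. a < 2 * k \<Longrightarrow> (\<Sum>u<k. T $$ (a, k + u)) = (if a < k then -1 else 1)"
proof -
  have Hc: "H \<in> carrier_mat n n" using H by (simp add: butson_iff)
  then obtain \<sigma> \<tau> R where \<sigma>: "\<sigma> permutes {..<n}" and \<tau>: "\<tau> permutes {..<n}"
    and R: "R = mat n n (\<lambda>(i, j). H $$ (\<sigma> i, \<tau> j))"
    and R0: "\<And>j. j < n \<Longrightarrow> R $$ (0, j) = 1" "\<And>i. i < n \<Longrightarrow> R $$ (i, 0) = 1"
    and R1: "row R 1 = sorted_pattern n" "col R 1 = sorted_pattern n"
    and TR: "T = mat (n - 2) (n - 2) (\<lambda>(i, j). R $$ (i + 2, j + 2))"
    using T by (auto simp: T_submatrices_def Let_def)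
  have perm: "\<sigma> i < n" "\<tau> i < n" if "i < n" for i
    using permutes_in_image[OF \<sigma>] permutes_in_image[OF \<tau>] that by auto
  show "T \<in> carrier_mat (2 * k) (2 * k)"
    using TR n by simp
  have T_idx: "T $$ (a, u) = R $$ (a + 2, u + 2)" if "a < 2 * k" "u < 2 * k" for a u
    using TR n that by simp
  show "T $$ (a, u) ^ m = 1" if "a < 2 * k" "u < 2 * k" for a u
    using H n that perm by (simp add: T_idx R butson_iff)
  \<comment> \<open>The column permutation only reorders the sum, and injectivity of
    \<open>\<sigma>\<close> keeps distinct rows distinct.\<close>
  have gram: "(\<Sum>l<n. R $$ (i, l) * cnj (R $$ (j, l))) = (if i = j then of_nat n else 0)"
    if "i < n" "j < n" for i j
  proof -
    have "(\<Sum>l<n. R $$ (i, l) * cnj (R $$ (j, l)))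
        = (\<Sum>l<n. H $$ (\<sigma> i, \<tau> l) * cnj (H $$ (\<sigma> j, \<tau> l)))"
      using that by (simp add: R)
    also have "\<dots> = (\<Sum>l<n. H $$ (\<sigma> i, l) * cnj (H $$ (\<sigma> j, l)))"
      using sum.permute[OF \<tau>, of "\<lambda>l. H $$ (\<sigma> i, l) * cnj (H $$ (\<sigma> j, l))"] by (simp add: o_def)
    also have "\<dots> = (if i = j then of_nat n else 0)"
      using H perm that permutes_inj[OF \<sigma>] by (simp add: butson_iff inj_eq)
    finally show ?thesis .
  qed
  have split: "(\<Sum>l<n. f l) = f 0 + f 1 + (\<Sum>u<2 * k. f (u + 2))" for f :: "nat \<Rightarrow> complex"
    by (simp add: n sum.lessThan_Suc_shift del: sum.lessThan_Suc)
  have halves: "(\<Sum>u<2 * k. f u) = (\<Sum>u<k. f u) + (\<Sum>u<k. f (k + u))" for f :: "nat \<Rightarrow> complex"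
    using sum.nat_group[of f k 2] sum.shift_bounds_nat_ivl[of f 0 k k]
    by (simp add: numeral_2_eq_2 lessThan_Suc mult_2 atLeast0LessThan add.commute)
  have row1: "R $$ (1, j) = sorted_pattern n $ j" if "j < n" for j
    using R1(1) that R by (metis One_nat_def dim_row_mat(1) index_row(1) dim_col_mat(1) n
        add_2_eq_Suc' less_Suc_eq_0_disj zero_less_Suc)
  have col1: "R $$ (j, 1) = sorted_pattern n $ j" if "j < n" for j
    using R1(2) that R by (metis One_nat_def dim_row_mat(1) index_col dim_col_mat(1) n
        add_2_eq_Suc' less_Suc_eq_0_disj zero_less_Suc)
  \<comment> \<open>The shift by 2 skips the indices split off, and \<open>(n - 2) div 2 = k\<close>
    puts the sign change exactly between the halves of \<open>T\<close>.\<close>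
  have col1': "R $$ (a + 2, 1) = (if a < k then 1 else -1)" if "a < 2 * k" for a
    using that col1[of "a + 2"] by (simp add: n sorted_pattern_def)
  have half_eq: "a div k = b div k \<longleftrightarrow> (a < k \<longleftrightarrow> b < k)" if "a < 2 * k" "b < 2 * k" for a b
    using that by (simp add: half_div)
  show "(\<Sum>u<2 * k. T $$ (a, u) * cnj (T $$ (b, u))) =
        (if a = b then of_nat n else 0) - (if a div k = b div k then 2 else 0)"
    if ab: "a < 2 * k" "b < 2 * k" for a b
  proof -
    have move: "S = g - r" if "r + S = g" for r S g :: complex
      using that by auto
    have "(\<Sum>l<n. R $$ (a + 2, l) * cnj (R $$ (b + 2, l))) = (if a = b then of_nat n else 0)"
      using gram[of "a + 2" "b + 2"] ab n by simp
    then have "1 + R $$ (a + 2, 1) * cnj (R $$ (b + 2, 1)) + (\<Sum>u<2 * k. T $$ (a, u) * cnj (T $$ (b, u)))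
        = (if a = b then of_nat n else 0)"
      unfolding split using ab R0(2)[of "a + 2"] R0(2)[of "b + 2"] n by (simp add: T_idx)
    then have "(\<Sum>u<2 * k. T $$ (a, u) * cnj (T $$ (b, u)))
        = (if a = b then of_nat n else 0) - (1 + R $$ (a + 2, 1) * cnj (R $$ (b + 2, 1)))"
      by (rule move)
    \<comment> \<open>The two signs multiply to 1 within a half and to -1 across the halves.\<close>
    also have "1 + R $$ (a + 2, 1) * cnj (R $$ (b + 2, 1)) = (if a div k = b div k then 2 else 0)"
      unfolding col1'[OF ab(1)] col1'[OF ab(2)] half_eq[OF ab] by simp
    finally show ?thesis .
  qed
  define P Q where "P a = (\<Sum>u<k. T $$ (a, u))" and "Q a = (\<Sum>u<k. T $$ (a, k + u))" for a
  \<comment> \<open>The first equation is orthogonality to the row of ones; the second row of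
    \<open>R\<close> flips the sign in column 1 and on the right half, which gives the second
    equation.\<close>
  have sums: "1 + (if a < k then 1 else -1) + (P a + Q a) = 0"
    "1 - (if a < k then 1 else -1) + (P a - Q a) = 0" if a: "a < 2 * k" for a
  proof -
    have "(\<Sum>l<n. R $$ (a + 2, l) * cnj (R $$ (0, l))) = 0"
      using gram[of "a + 2" 0] a n by simp
    then show "1 + (if a < k then 1 else -1) + (P a + Q a) = 0"
      unfolding split halves col1'[OF a] using a R0 n by (simp add: T_idx P_def Q_def add.assoc)
    have "(\<Sum>l<n. R $$ (a + 2, l) * cnj (R $$ (1, l))) = 0"
      using gram[of "a + 2" 1] a n by simp
    then show "1 - (if a < k then 1 else -1) + (P a - Q a) = 0"
      unfolding split halves col1'[OF a] using a R0(2) n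
      by (simp add: row1[unfolded One_nat_def] sorted_pattern_def T_idx P_def Q_def sum_negf
          split: if_splits)
  qed
  have solve: "p = -1 \<and> q = - e" if "1 + e + (p + q) = 0" "1 - e + (p - q) = 0" for p q e :: complex
  proof -
    have "2 * (p + 1) = (1 + e + (p + q)) + (1 - e + (p - q))"
      "2 * (q + e) = (1 + e + (p + q)) - (1 - e + (p - q))"
      by (simp_all add: algebra_simps)
    then have "p + 1 = 0" "q + e = 0" unfolding that by (simp_all del: distrib_left_numeral)
    then show ?thesis by (simp only: eq_neg_iff_add_eq_0 simp_thms)
  qed
  show "(\<Sum>u<k. T $$ (a, u)) = -1" "(\<Sum>u<k. T $$ (a, k + u)) = (if a < k then -1 else 1)"
    if "a < 2 * k" for a
    using solve[OF sums[OF that]] by (auto simp: P_def Q_def)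
qed

section \<open>Coincidences between rows of B\<close>

text \<open>The row of \<open>T\<close> that occurs in block column \<open>t\<close> of row \<open>a\<close> of block row \<open>s\<close> of \<open>B\<close>.\<close>

definition T_row_index :: "nat \<Rightarrow> nat mat list \<Rightarrow> nat \<Rightarrow> nat \<Rightarrow> nat \<Rightarrow> nat" where
  "T_row_index k Ls s a t = k * (a div k) +
     (if t = 0 then s else if s = 0 then a mod k else (Ls ! (s - 1)) $$ (a mod k, t - 1) - 1)"

lemma latin_square_entry_le:
  assumes "latin_square k L" "i < k" "j < k"
  shows "1 \<le> L $$ (i, j)" "L $$ (i, j) \<le> k"
  using assms by (auto simp: latin_square_def)

lemma
  assumes "latin_square k L" "c \<in> {1..k}" "i < k"
  shows latin_square_row: "\<exists>!j. j < k \<and> L $$ (i, j) = c"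
    and latin_square_col: "\<exists>!j. j < k \<and> L $$ (j, i) = c"
  using assms by (simp_all add: latin_square_def)

text \<open>Symbols run from 1 to \<open>k\<close>, so the offset obtained by subtracting 1 is below
  \<open>k\<close> and never leaves the half \<open>a div k\<close>.\<close>

lemma T_row_index_half:
  assumes "\<And>s. s < k - 1 \<Longrightarrow> latin_square k (Ls ! s)" "s < k" "a < 2 * k" "t < k + 1"
  shows "T_row_index k Ls s a t div k = a div k" "T_row_index k Ls s a t < 2 * k"
proof -
  have k: "k > 0" using assms(2) by simp
  define c where "c = T_row_index k Ls s a t - k * (a div k)"
  have "(Ls ! (s - 1)) $$ (a mod k, t - 1) - 1 < k" if "s > 0" "t > 0"
  proof -
    have "s - 1 < k - 1" "a mod k < k" "t - 1 < k" using that assms(2,4) k by auto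
    from latin_square_entry_le[OF assms(1)[OF this(1)] this(2,3)] show ?thesis by linarith
  qed
  then have "c < k"
    using assms(2) k by (simp add: c_def T_row_index_def)
  moreover have eq: "T_row_index k Ls s a t = k * (a div k) + c"
    by (simp add: c_def T_row_index_def)
  ultimately show "T_row_index k Ls s a t div k = a div k" "T_row_index k Ls s a t < 2 * k"
    using k assms(3) by (auto simp: half_div)
qed

text \<open>Two rows of one block row meet only in block column 0. Block row 0 against a later one
  is the row property of a Latin square, and two different later block rows are LSESC. By symmetry
  \<open>s \<le> s'\<close> may be assumed.\<close>

lemma T_row_index_agree:
  assumes latin: "\<And>s. s < k - 1 \<Longrightarrow> latin_square k (Ls ! s)"
    and lsesc: "\<And>s s'. s < k - 1 \<Longrightarrow> s' < k - 1 \<Longrightarrow> s \<noteq> s' \<Longrightarrow> LSESC k (Ls ! s) (Ls ! s')"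
    and "s < k" "s' < k" "a div k = a' div k" "(s, a) \<noteq> (s', a')"
  shows "\<exists>!t. t < k + 1 \<and> T_row_index k Ls s a t = T_row_index k Ls s' a' t"
  using assms(3-6)
proof (induction s s' arbitrary: a a' rule: linorder_wlog)
  case (le s s')
  then have mods: "a mod k < k" "a' mod k < k"
    by auto
  consider (same) "s = s'" | (first) "s = 0" "s' > 0" | (later) "s > 0" "s < s'"
    using le(1) by linarith
  then show ?case
  proof cases
    case same
    then have ne: "a mod k \<noteq> a' mod k"
      using le by (metis div_mult_mod_eq)
    \<comment> \<open>Block row 0 uses \<open>a mod k\<close> itself here; in the other block rows,
      a column of the Latin square never repeats a symbol.\<close>
    have *: "T_row_index k Ls s a t \<noteq> T_row_index k Ls s a' t" if t: "0 < t" "t < k + 1" for t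
    proof (cases "s = 0")
      case False
      then have L: "latin_square k (Ls ! (s - 1))"
        using le latin by simp
      have t': "t - 1 < k" using t by simp
      let ?e = "(Ls ! (s - 1)) $$ (a mod k, t - 1)"
      have "\<exists>!i. i < k \<and> (Ls ! (s - 1)) $$ (i, t - 1) = ?e"
        using latin_square_entry_le[OF L mods(1) t'] by (intro latin_square_col[OF L _ t']) simp
      then have "?e \<noteq> (Ls ! (s - 1)) $$ (a' mod k, t - 1)"
        using ne mods by metis
      \<comment> \<open>Truncated subtraction loses nothing because symbols are at least 1.\<close>
      then have "?e - 1 \<noteq> (Ls ! (s - 1)) $$ (a' mod k, t - 1) - 1"
        using latin_square_entry_le[OF L mods(1) t'] latin_square_entry_le[OF L mods(2) t'] by linarith
      then show ?thesis
        using False t le(4) by (simp add: T_row_index_def)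
    qed (use t ne in \<open>auto simp: T_row_index_def\<close>)
    show ?thesis
    proof (intro ex1I[of _ 0])
      fix t assume "t < k + 1 \<and> T_row_index k Ls s a t = T_row_index k Ls s' a' t"
      then show "t = 0"
        using * same by blast
    qed (use same le in \<open>auto simp: T_row_index_def\<close>)
  next
    case first
    have L: "latin_square k (Ls ! (s' - 1))"
      using first le latin by simp
    \<comment> \<open>After block column 0, block row 0 always uses the offset
      \<open>a mod k\<close>, which corresponds to the symbol \<open>a mod k + 1\<close>.\<close>
    have "a mod k + 1 \<in> {1..k}"
      using mods(1) by (simp add: Suc_le_eq)
    from latin_square_row[OF L this mods(2)] obtain j where j: "j < k" "(Ls ! (s' - 1)) $$ (a' mod k, j) = a mod k + 1"
      and uniq: "\<And>j'. j' < k \<Longrightarrow> (Ls ! (s' - 1)) $$ (a' mod k, j') = a mod k + 1 \<Longrightarrow> j' = j"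
      by blast
    show ?thesis
    \<comment> \<open>Slice \<open>j\<close> sits in block column \<open>j + 1\<close>. Block column
      0 is ruled out, since there the offsets are 0 and \<open>s'\<close>.\<close>
    proof (intro ex1I[of _ "j + 1"])
      fix t assume t: "t < k + 1 \<and> T_row_index k Ls s a t = T_row_index k Ls s' a' t"
      have "t \<noteq> 0"
      proof
        assume "t = 0"
        with t first le(4) show False by (simp add: T_row_index_def)
      qed
      then have t': "t - 1 < k" using conjunct1[OF t] by linarith
      have "a mod k = (Ls ! (s' - 1)) $$ (a' mod k, t - 1) - 1"
        using t \<open>t \<noteq> 0\<close> first le(4) by (simp add: T_row_index_def)
      then have "(Ls ! (s' - 1)) $$ (a' mod k, t - 1) = a mod k + 1"
        using latin_square_entry_le[OF L mods(2) t'] by linarith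
      from uniq[OF t' this] show "t = j + 1"
        using \<open>t \<noteq> 0\<close> by simp
    qed (use j first le in \<open>auto simp: T_row_index_def\<close>)
  next
    case later
    let ?L = "Ls ! (s - 1)" and ?L' = "Ls ! (s' - 1)"
    \<comment> \<open>\<open>0 < s < s'\<close> makes the positions \<open>s - 1\<close> and
      \<open>s' - 1\<close> different, as LSESC requires.\<close>
    have L: "latin_square k ?L" "latin_square k ?L'" and "LSESC k ?L ?L'"
      using later le latin lsesc by auto
    then obtain j where j: "j < k" "?L $$ (a mod k, j) = ?L' $$ (a' mod k, j)"
      and uniq: "\<And>j'. j' < k \<Longrightarrow> ?L $$ (a mod k, j') = ?L' $$ (a' mod k, j') \<Longrightarrow> j' = j"
      using mods unfolding LSESC_def by metis
    show ?thesis
    proof (intro ex1I[of _ "j + 1"])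
      fix t assume t: "t < k + 1 \<and> T_row_index k Ls s a t = T_row_index k Ls s' a' t"
      have "t \<noteq> 0"
      proof
        assume "t = 0"
        with t later le(4) show False by (simp add: T_row_index_def)
      qed
      then have t': "t - 1 < k" using conjunct1[OF t] by linarith
      have "?L $$ (a mod k, t - 1) - 1 = ?L' $$ (a' mod k, t - 1) - 1"
        using t \<open>t \<noteq> 0\<close> later le(4) by (simp add: T_row_index_def)
      then have "?L $$ (a mod k, t - 1) = ?L' $$ (a' mod k, t - 1)"
        using latin_square_entry_le[OF L(1) mods(1) t'] latin_square_entry_le[OF L(2) mods(2) t'] by linarith
      from uniq[OF t' this] show "t = j + 1"
        using \<open>t \<noteq> 0\<close> by simp
    qed (use j later le in \<open>auto simp: T_row_index_def\<close>)
  qed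
next
  case (sym s s')
  have "\<exists>!t. t < k + 1 \<and> T_row_index k Ls s' a' t = T_row_index k Ls s a t"
    using sym(2-5) by (intro sym(1)) auto
  then show ?case
    by (simp add: eq_commute)
qed

section \<open>Entries of the assembled matrix B\<close>

text \<open>The halves of block column \<open>t\<close> are scaled by the entries
  \<open>2 * t\<close> and \<open>2 * t + 1\<close> of \<open>x\<close>. Both cases are entry
  \<open>j div k\<close>, so the factor is constant on runs of \<open>k\<close> columns.\<close>

lemma B_matrix_index:
  assumes T: "T \<in> carrier_mat (2 * k) (2 * k)"
    and latin: "\<And>s. s < k - 1 \<Longrightarrow> latin_square k (Ls ! s)" and len: "length Ls = k - 1"
    and s: "s < k" and a: "a < 2 * k" and j: "j < (k + 1) * (2 * k)"
  shows "B_matrix k (map tensor_of Ls) x T $$ (s * (2 * k) + a, j) =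
    x $ (j div k) * T $$ (T_row_index k Ls s a (j div (2 * k)), j mod (2 * k))"
proof -
  define t u where "t = j div (2 * k)" and "u = j mod (2 * k)"
  have k: "k > 0" using s by simp
  have t: "t < k + 1" and u: "u < 2 * k"
    using j k by (auto simp: t_def u_def less_mult_imp_div_less)
  have jk: "j div k = 2 * t + (if u < k then 0 else 1)"
  proof -
    have "j = k * (2 * t) + u"
      using mult_div_mod_eq[of "2 * k" j] by (simp add: t_def u_def ac_simps)
    then show ?thesis
      using k half_div[OF u] by simp
  qed
  have "s * (2 * k) + a < (s + 1) * (2 * k)"
    using a by simp
  also have "\<dots> \<le> k * (2 * k)"
    using s by (intro mult_right_mono) auto
  finally have row_less: "s * (2 * k) + a < k * (2 * k)" .
  have "(s * (2 * k) + a) div (2 * k) = s" "(s * (2 * k) + a) mod (2 * k) = a"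
    using a by simp_all
  with row_less have "B_matrix k (map tensor_of Ls) x T $$ (s * (2 * k) + a, j) =
     (if t = 0 then E_block k T s (x $ 0) (x $ 1)
      else let S = T_scaled k T (x $ (2 * t)) (x $ (2 * t + 1)) in
       if s = 0 then S else (1\<^sub>m 2 \<otimes>\<^sub>K (map tensor_of Ls ! (s - 1) ! (t - 1))) * S) $$ (a, u)"
    using j by (simp only: B_matrix_def block_grid_def t_def u_def index_mat prod.case)
  also have "\<dots> = x $ (j div k) * T $$ (T_row_index k Ls s a t, u)"
  proof -
    consider (E) "t = 0" | (top) "t > 0" "s = 0" | (low) "t > 0" "s > 0" by auto
    then show ?thesis
    proof cases
      case E
      then show ?thesis
        using E_block_index[OF T a u s] by (simp add: T_row_index_def jk)
    next
      case top
      then show ?thesis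
        using T_scaled_index[OF T a u] by (simp add: T_row_index_def jk)
    next
      case low
      define L where "L = Ls ! (s - 1)"
      have L: "latin_square k L" using latin low s by (simp add: L_def)
      have am: "a mod k < k" "t - 1 < k" using k low t by auto
      have b: "(L $$ (a mod k, t - 1) - 1) < k"
        using latin_square_entry_le[OF L am] by simp
      have "map tensor_of Ls ! (s - 1) ! (t - 1) =
          mat k k (\<lambda>(i, j). if L $$ (i, t - 1) = j + 1 then 1 else 0)"
        using len s low L am by (auto simp: L_def tensor_of_def latin_square_def Let_def)
      \<comment> \<open>Symbols are at least 1, so the shift can be moved to the left, which gives
        the row selection form with \<open>f i = L $$ (i, t - 1) - 1\<close>.\<close>
      also have "\<dots> = mat k k (\<lambda>(i, j). if L $$ (i, t - 1) - 1 = j then 1 else 0)"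
        using latin_square_entry_le[OF L _ am(2)] by (intro eq_matI) fastforce+
      finally have X: "map tensor_of Ls ! (s - 1) ! (t - 1) =
          mat k k (\<lambda>(i, j). if L $$ (i, t - 1) - 1 = j then 1 else 0)" .
      have "T_row_index k Ls s a t = k * (a div k) + (L $$ (a mod k, t - 1) - 1)"
        using low by (simp add: T_row_index_def L_def)
      then show ?thesis
        using slice_kronecker_mult_index[OF T_scaled_carrier[OF T] a u b X, of "x $ (2 * t)" "x $ (2 * t + 1)"]
          T_scaled_index[OF T T_row_index_half(2)[OF latin s a t] u] low
        by (simp add: Let_def jk)
    qed
  qed
  finally show ?thesis by (simp add: t_def u_def)
qed

section \<open>Orthogonality of the rows of the full matrix\<close>

theorem theorem2:
  fixes m n p q :: nat and H T :: "complex mat"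
    and \<X> :: "complex mat list set" and Xs :: "complex mat list list"
  assumes "even m" and "m > 0" and "even n" and "n \<ge> 4"
    and "H \<in> A12 m n"
    and "p < n" and "q < n" and "row H q = alternate (row H p)"
    and "T \<in> T_submatrices H"
    and "complete_tensor_set (n div 2 - 1) \<X>"
    and "distinct Xs" and "set Xs = \<X>"
  shows "Psi Xs H p q T \<in> butson m ((n div 2 - 1) * n)"
proof -
  define k where "k = n div 2 - 1"
  have n: "n = 2 * k + 2" and k: "k > 0"
    using assms(3,4) by (auto simp: k_def)
  have H: "H \<in> butson m n"
    using assms(5) by (simp add: A12_def A1_def normalized_butson_def)
  then have Hc: "H \<in> carrier_mat n n"
    and H_root: "\<And>i j. i < n \<Longrightarrow> j < n \<Longrightarrow> H $$ (i, j) ^ m = 1"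
    and H_gram: "\<And>i j. i < n \<Longrightarrow> j < n \<Longrightarrow>
      (\<Sum>l<n. H $$ (i, l) * cnj (H $$ (j, l))) = (if i = j then of_nat n else 0)"
    by (auto simp: butson_iff)
  have Hq: "H $$ (q, c) = (- 1) ^ c * H $$ (p, c)" if "c < n" for c
    using arg_cong[OF assms(8), of "\<lambda>v. v $ c"] that assms(6,7) Hc by (simp add: alternate_def)
  \<comment> \<open>Otherwise the entry in column 1 equals its own negative, and 0 is not a root of
    unity since \<open>m > 0\<close>.\<close>
  have "p \<noteq> q"
  proof
    assume "p = q"
    then have "H $$ (p, 1) = 0" using Hq[of 1] n by simp
    then show False using H_root[of p 1] assms(2,6) n by (simp add: power_0_left)
  qed
  note T = T_submatrix_gram[OF H n assms(9)]
  obtain Ls where Xs: "Xs = map tensor_of Ls" and len: "length Ls = k - 1"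
    and latin: "\<And>s. s < k - 1 \<Longrightarrow> latin_square k (Ls ! s)"
    and lsesc: "\<And>s s'. s < k - 1 \<Longrightarrow> s' < k - 1 \<Longrightarrow> s \<noteq> s' \<Longrightarrow> LSESC k (Ls ! s) (Ls ! s')"
    using complete_tensor_set_enum[OF assms(10-12)] unfolding k_def by blast
  \<comment> \<open>\<open>submatrix\<close> lists the kept rows by \<open>pick\<close> on this
    infinite set; exactly \<open>2 * k\<close> of its elements lie below \<open>n\<close>, so the
    first \<open>2 * k\<close> picks are the rows of \<open>H\<close> other than \<open>p\<close>
    and \<open>q\<close>.\<close>
  define \<rho> where "\<rho> = pick (- {p, q})"
  have card: "card {i. i < n \<and> i \<in> - {p, q}} = 2 * k"
  proof -
    have "{i. i < n \<and> i \<in> - {p, q}} = {..<n} - {p, q}" by auto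
    then show ?thesis
      using \<open>p \<noteq> q\<close> assms(6,7) n by (simp add: card_Diff_subset)
  qed
  have inf: "infinite (- {p, q})" by (simp add: Compl_eq_Diff_UNIV)
  have \<rho>: "\<rho> r < n" "\<rho> r \<noteq> p" "\<rho> r \<noteq> q" if "r < 2 * k" for r
    using pick_le[of r n "- {p, q}"] pick_in_set_inf[OF inf, of r] that card by (auto simp: \<rho>_def)
  have \<rho>_eq: "\<rho> r = \<rho> r' \<longleftrightarrow> r = r'" for r r'
    using pick_eq_iff_inf[OF inf] by (auto simp: \<rho>_def)
  define N where "N = k * n"
  \<comment> \<open>Columns are read as \<open>k + 1\<close> blocks of width \<open>2 * k\<close> or
    as \<open>n\<close> runs of length \<open>k\<close>; rows as \<open>2 * k\<close> upper rows
    followed by \<open>k\<close> block rows of height \<open>2 * k\<close>.\<close>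
  have N: "N = (k + 1) * (2 * k)" "N = n * k" "N = 2 * k + k * (2 * k)"
    by (auto simp: N_def n algebra_simps)
  define P where "P = Psi Xs H p q T"
  define \<phi> where "\<phi> = T_row_index k Ls"
  have P_def': "P = (submatrix H (- {p, q}) UNIV \<otimes>\<^sub>K ones_row k) @\<^sub>r B_matrix k Xs (row H p) T"
    using Hc by (simp add: P_def Psi_def k_def Let_def)
  have sub_dims: "dim_row (submatrix H (- {p, q}) UNIV) = 2 * k" "dim_col (submatrix H (- {p, q}) UNIV) = n"
    using Hc card by (simp_all add: dim_submatrix)
  then have B0: "submatrix H (- {p, q}) UNIV \<otimes>\<^sub>K ones_row k \<in> carrier_mat (2 * k) N"
    by (auto simp: kronecker_def ones_row_def N(2))
  have B: "B_matrix k Xs (row H p) T \<in> carrier_mat (k * (2 * k)) N"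
    by (auto simp: B_matrix_def block_grid_def N(1))
  have P: "P \<in> carrier_mat N N"
    using carrier_append_rows[OF B0 B] by (simp only: P_def' N(3))
  have div_less: "j div k < n" if "j < N" for j
    using that by (simp add: N(2) less_mult_imp_div_less)
  have P_top: "P $$ (r, j) = H $$ (\<rho> r, j div k)" if "r < 2 * k" "j < N" for r j
  proof -
    have "P $$ (r, j) = (submatrix H (- {p, q}) UNIV \<otimes>\<^sub>K ones_row k) $$ (r, j)"
      using B0 B that by (simp add: P_def' append_rows_def)
    also have "\<dots> = submatrix H (- {p, q}) UNIV $$ (r, j div k)"
      using that sub_dims k by (simp add: kronecker_def ones_row_def N(2))
    also have "\<dots> = H $$ (\<rho> r, j div k)"
      using that Hc card div_less by (subst submatrix_index) (auto simp: pick_UNIV \<rho>_def)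
    finally show ?thesis .
  qed
  have P_bot: "P $$ (2 * k + (s * (2 * k) + a), j) =
      H $$ (p, j div k) * T $$ (\<phi> s a (j div (2 * k)), j mod (2 * k))"
    if "s < k" "a < 2 * k" "j < N" for s a j
  proof -
    have "s * (2 * k) + a < (s + 1) * (2 * k)"
      using that by simp
    also have "\<dots> \<le> k * (2 * k)"
      using that by (intro mult_right_mono) auto
    finally have "P $$ (2 * k + (s * (2 * k) + a), j) = B_matrix k Xs (row H p) T $$ (s * (2 * k) + a, j)"
      using B0 B that by (simp add: P_def' append_rows_def)
    also have "\<dots> = row H p $ (j div k) * T $$ (\<phi> s a (j div (2 * k)), j mod (2 * k))"
      unfolding Xs \<phi>_def using that by (intro B_matrix_index[OF T(1) latin len]) (auto simp: N(1))
    also have "row H p $ (j div k) = H $$ (p, j div k)"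
      using Hc assms(6) div_less[OF that(3)] by simp
    finally show ?thesis .
  qed
  have \<phi>: "\<phi> s a t div k = a div k" "\<phi> s a t < 2 * k" if "s < k" "a < 2 * k" "t < k + 1" for s a t
    using T_row_index_half[OF latin that] by (auto simp: \<phi>_def)
  have rows: thesis
    if "i < N" "i < 2 * k \<Longrightarrow> thesis"
      "\<And>s a. s < k \<Longrightarrow> a < 2 * k \<Longrightarrow> i = 2 * k + (s * (2 * k) + a) \<Longrightarrow> thesis" for i thesis
  proof (cases "i < 2 * k")
    case False
    define b where "b = i - 2 * k"
    show thesis
    proof (rule that(3))
      show "b div (2 * k) < k" using that(1) False by (simp add: b_def N(3) less_mult_imp_div_less)
      show "b mod (2 * k) < 2 * k" using k by simp
      show "i = 2 * k + (b div (2 * k) * (2 * k) + b mod (2 * k))"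
        unfolding div_mult_mod_eq using False by (simp add: b_def)
    qed
  next
    case True
    then show thesis by (rule that(2))
  qed
  have div2: "j div (2 * k) < k + 1" if "j < N" for j
    using that by (simp only: N(1) less_mult_imp_div_less)
  have P_root: "P $$ (i, j) ^ m = 1" if "i < N" "j < N" for i j
  proof (rule rows[OF that(1)])
    assume "i < 2 * k"
    then show ?thesis using that P_top \<rho> H_root div_less by simp
  next
    fix s a assume sa: "s < k" "a < 2 * k" and i: "i = 2 * k + (s * (2 * k) + a)"
    show ?thesis
      unfolding i P_bot[OF sa that(2)] power_mult_distrib
      using k H_root[OF assms(6) div_less[OF that(2)]] T(2) \<phi>(2)[OF sa div2[OF that(2)]] by simp
  qed
  \<comment> \<open>Every column of \<open>H\<close> is repeated \<open>k\<close> times, so the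
    inner product is \<open>k\<close> times the one in \<open>H\<close>.\<close>
  have top_top: "(\<Sum>j<N. P $$ (r, j) * cnj (P $$ (r', j))) = (if r = r' then of_nat N else 0)"
    if r: "r < 2 * k" "r' < 2 * k" for r r'
  proof -
    have "(\<Sum>j<N. P $$ (r, j) * cnj (P $$ (r', j)))
        = (\<Sum>j<n * k. H $$ (\<rho> r, j div k) * cnj (H $$ (\<rho> r', j div k)))"
      using r by (simp add: P_top N(2))
    also have "\<dots> = of_nat k * (\<Sum>c<n. H $$ (\<rho> r, c) * cnj (H $$ (\<rho> r', c)))"
      by (subst sum_div_mod_split[of "\<lambda>c _. H $$ (\<rho> r, c) * cnj (H $$ (\<rho> r', c))"])
        (simp add: sum_distrib_left)
    finally show ?thesis
      using H_gram \<rho> r by (simp add: \<rho>_eq N_def)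
  qed
  have bot_top: "(\<Sum>j<N. P $$ (2 * k + (s * (2 * k) + a), j) * cnj (P $$ (r, j))) = 0"
    if r: "r < 2 * k" and sa: "s < k" "a < 2 * k" for r s a
  proof -
    \<comment> \<open>Summing over runs leaves minus row \<open>y\<close>: half sums -1, -1 give row
      \<open>p\<close>, and half sums -1, 1 restore the alternating signs of row
      \<open>q\<close>.\<close>
    define y where "y = (if a < k then p else q)"
    have half: "(\<Sum>v<k. T $$ (\<phi> s a (c div 2), k * (c mod 2) + v)) * H $$ (p, c) = - H $$ (y, c)"
      if c: "c < n" for c
    proof -
      have c2: "c div 2 < k + 1" using c n by auto
      have "\<phi> s a (c div 2) < k \<longleftrightarrow> a < k"
        using \<phi>[OF sa c2] sa half_div by (metis zero_neq_one)
      note sums = T(4,5)[OF \<phi>(2)[OF sa c2], unfolded this]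
      show ?thesis
      proof (cases "even c")
        case True
        then have "c mod 2 = 0" by presburger
        then show ?thesis using sums True Hq[OF c] by (simp add: y_def)
      next
        case False
        then have "c mod 2 = 1" by presburger
        then show ?thesis using sums False Hq[OF c] by (simp add: y_def)
      qed
    qed
    have "(\<Sum>j<N. P $$ (2 * k + (s * (2 * k) + a), j) * cnj (P $$ (r, j)))
        = (\<Sum>j<n * k. H $$ (p, j div k) * T $$ (\<phi> s a (j div k div 2), k * (j div k mod 2) + j mod k)
             * cnj (H $$ (\<rho> r, j div k)))"
    proof (intro sum.cong)
      fix j assume "j \<in> {..<n * k}"
      then have j: "j < N" by (simp add: N(2))
      \<comment> \<open>Run \<open>c\<close> is half \<open>c mod 2\<close> of block column
        \<open>c div 2\<close>.\<close>
      have "j div (2 * k) = j div k div 2" "j mod (2 * k) = k * (j div k mod 2) + j mod k"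
        using div_mult2_eq[of j k 2] mod_mult2_eq[of j k 2] by (simp_all add: mult.commute)
      then show "P $$ (2 * k + (s * (2 * k) + a), j) * cnj (P $$ (r, j))
          = H $$ (p, j div k) * T $$ (\<phi> s a (j div k div 2), k * (j div k mod 2) + j mod k)
             * cnj (H $$ (\<rho> r, j div k))"
        by (simp only: P_top[OF r j] P_bot[OF sa j])
    qed (simp add: N(2))
    also have "\<dots> = (\<Sum>c<n. \<Sum>v<k. H $$ (p, c) * T $$ (\<phi> s a (c div 2), k * (c mod 2) + v)
             * cnj (H $$ (\<rho> r, c)))"
      by (rule sum_div_mod_split[of "\<lambda>c v. H $$ (p, c) * T $$ (\<phi> s a (c div 2), k * (c mod 2) + v)
             * cnj (H $$ (\<rho> r, c))"])
    also have "\<dots> = (\<Sum>c<n. ((\<Sum>v<k. T $$ (\<phi> s a (c div 2), k * (c mod 2) + v)) * H $$ (p, c))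
             * cnj (H $$ (\<rho> r, c)))"
      by (simp add: sum_distrib_left sum_distrib_right mult_ac)
    also have "\<dots> = (\<Sum>c<n. - (H $$ (y, c) * cnj (H $$ (\<rho> r, c))))"
      by (intro sum.cong refl) (simp only: half lessThan_iff mult_minus_left)
    also have "\<dots> = - (\<Sum>c<n. H $$ (y, c) * cnj (H $$ (\<rho> r, c)))"
      by (rule sum_negf)
    also have "\<dots> = 0"
      \<comment> \<open>Rows \<open>p\<close> and \<open>q\<close> were deleted from the upper part,
        so \<open>\<rho> r\<close> differs from \<open>y\<close>.\<close>
      using H_gram[of y "\<rho> r"] \<rho>[OF r] assms(6,7) by (auto simp: y_def)
    finally show ?thesis .
  qed
  have bot_bot: "(\<Sum>j<N. P $$ (2 * k + (s * (2 * k) + a), j) * cnj (P $$ (2 * k + (s' * (2 * k) + a'), j)))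
      = (if (s, a) = (s', a') then of_nat N else 0)"
    if sa: "s < k" "a < 2 * k" and sa': "s' < k" "a' < 2 * k" for s a s' a'
  proof -
    define Z where "Z = {t. t < k + 1 \<and> \<phi> s a t = \<phi> s' a' t}"
    \<comment> \<open>Both rows carry the same factor of norm 1 in each column, so it
      cancels.\<close>
    have [simp]: "H $$ (p, j div k) * T $$ e * cnj (H $$ (p, j div k) * T $$ e') = T $$ e * cnj (T $$ e')"
      if "j < N" for j e e'
    proof -
      have "H $$ (p, j div k) * T $$ e * cnj (H $$ (p, j div k) * T $$ e') =
         (H $$ (p, j div k) * cnj (H $$ (p, j div k))) * (T $$ e * cnj (T $$ e'))"
        by simp
      then show ?thesis
        using root_mult_cnj[OF H_root[OF assms(6) div_less[OF that]] assms(2)] by simp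
    qed
    have "(\<Sum>j<N. P $$ (2 * k + (s * (2 * k) + a), j) * cnj (P $$ (2 * k + (s' * (2 * k) + a'), j)))
       = (\<Sum>j<(k + 1) * (2 * k). T $$ (\<phi> s a (j div (2 * k)), j mod (2 * k))
            * cnj (T $$ (\<phi> s' a' (j div (2 * k)), j mod (2 * k))))"
      unfolding N(1)[symmetric] using sa sa' P_bot by (intro sum.cong) (auto simp del: complex_cnj_mult)
    also have "\<dots> = (\<Sum>t<k + 1. \<Sum>u<2 * k. T $$ (\<phi> s a t, u) * cnj (T $$ (\<phi> s' a' t, u)))"
      by (rule sum_div_mod_split[of "\<lambda>t u. T $$ (\<phi> s a t, u) * cnj (T $$ (\<phi> s' a' t, u))"])
    also have "\<dots> = (\<Sum>t<k + 1. (if \<phi> s a t = \<phi> s' a' t then of_nat n else 0)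
        - (if a div k = a' div k then 2 else 0))"
      using \<phi>[OF sa] \<phi>[OF sa'] by (intro sum.cong refl) (simp add: T(3))
    \<comment> \<open>Each of the \<open>k + 1\<close> blocks loses 2 when the halves agree, and
      \<open>2 * (k + 1) = n\<close>.\<close>
    also have "\<dots> = of_nat (card Z * n) - (if a div k = a' div k then of_nat n else 0)"
      by (simp add: sum_subtractf Z_def n sum.If_cases lessThan_def Int_def algebra_simps
          del: sum.lessThan_Suc)
    also have "\<dots> = (if (s, a) = (s', a') then of_nat N else 0)"
    proof (cases "a div k = a' div k")
      case False
      then have "Z = {}"
        using \<phi>(1)[OF sa] \<phi>(1)[OF sa'] by (auto simp: Z_def) metis
      then show ?thesis using False by auto
    next
      case True
      show ?thesis
      proof (cases "(s, a) = (s', a')")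
        case True
        \<comment> \<open>All \<open>k + 1\<close> blocks coincide, leaving
          \<open>(k + 1) * n - n = N\<close>.\<close>
        then have "Z = {..<k + 1}" by (auto simp: Z_def)
        then have "card Z * n = N + n" by (simp add: N_def algebra_simps)
        then show ?thesis using True by simp
      next
        case False
        \<comment> \<open>The single common block contributes \<open>n\<close>, exactly the amount
          subtracted.\<close>
        have "\<exists>!t. t \<in> Z"
          using T_row_index_agree[OF latin lsesc sa(1) sa'(1) True False] by (simp add: Z_def \<phi>_def)
        then obtain t where "Z = {t}" by auto
        then show ?thesis using True False by auto
      qed
    qed
    finally show ?thesis .
  qed
  have "(\<Sum>l<N. P $$ (i, l) * cnj (P $$ (j, l))) = (if i = j then of_nat N else 0)"
    if ij: "i < N" "j < N" for i j
  proof (rule rows[OF ij(1)]; rule rows[OF ij(2)])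
    assume "i < 2 * k" "j < 2 * k"
    then show ?thesis by (rule top_top)
  next
    fix s a assume i: "i < 2 * k" and sa: "s < k" "a < 2 * k" and j: "j = 2 * k + (s * (2 * k) + a)"
    \<comment> \<open>Hermitian symmetry reduces this case to \<open>bot_top\<close>.\<close>
    have "(\<Sum>l<N. P $$ (i, l) * cnj (P $$ (j, l))) = cnj (\<Sum>l<N. P $$ (j, l) * cnj (P $$ (i, l)))"
      by (simp add: mult.commute)
    then show ?thesis
      using bot_top[OF i sa] i j by simp
  next
    fix s a assume "j < 2 * k" "s < k" "a < 2 * k" "i = 2 * k + (s * (2 * k) + a)"
    then show ?thesis
      using bot_top by simp
  next
    fix s a s' a' assume sa: "s < k" "a < 2 * k" and i: "i = 2 * k + (s * (2 * k) + a)"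
      and sa': "s' < k" "a' < 2 * k" and j: "j = 2 * k + (s' * (2 * k) + a')"
    have "i = j \<longleftrightarrow> (s, a) = (s', a')"
    proof
      assume "i = j"
      then have eq: "s * (2 * k) + a = s' * (2 * k) + a'" by (simp add: i j)
      from arg_cong[OF eq, of "\<lambda>b. b div (2 * k)"] arg_cong[OF eq, of "\<lambda>b. b mod (2 * k)"]
      show "(s, a) = (s', a')" using sa sa' by simp
    qed (simp add: i j)
    then show ?thesis
      using bot_bot[OF sa sa'] by (simp only: i j)
  qed
  then have "P \<in> butson m N"
    using P P_root by (simp add: butson_iff)
  then show ?thesis
    by (simp add: P_def N_def k_def)
qed

end
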